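(* For any sequence of positive numbers $\alpha=\{\alpha_k\}_k$, the set $\mathscr{O}_\alpha$ is dense in $L^1_0(\mathbb{R}^d)$.
   Context: For $\varepsilon>0$, $L^1_\varepsilon(\mathbb{R}^d)=\{f\in L^1_{\rm loc}(\mathbb{R}^d):\int e^{-\varepsilon|x|^2}|f(x)|\,\mathrm{d}x<\infty\}$ with norm $\|f\|_{L^1_\varepsilon}=(\varepsilon/\pi)^{d/2}\int e^{-\varepsilon|x|^2}|f(x)|\,\mathrm{d}x$; $L^1_0(\mathbb{R}^d)=\bigcap_{\varepsilon>0}L^1_\varepsilon(\mathbb{R}^d)$ with the Fréchet topology generated by all these norms: $u_n\to u$ in $L^1_0$ iff $u_n\to u$ in $L^1_\varepsilon$ for every $\varepsilon>0$. Given $\alpha=\{\alpha_k\}_k$, $\mathscr{O}_\alpha$ is the (nonempty) set of all $0\le u_0\in L^1_0(\mathbb{R}^d)$ for which there is a sequence $t_n\to\infty$ such that for every $k$ there is a subsequence $\{t_{k,j}\}_j$ of $\{t_n\}_n$ with $u(0,t_{k,j})\to\alpha_k$ as $j\to\infty$, where $u(x,t)=(4\pi t)^{-d/2}\int_{\mathbb{R}^d}e^{-|x-y|^2/4t}u_0(y)\,\mathrm{d}y$.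
   Formalization: Since O_α has only nonnegative functions, it is not dense among signed functions (e.g. minus the indicator of a ball). Proved instead: O_α is dense in the nonnegative functions of L^1_0, and O_α without the condition u_0 ≥ 0 is dense in all of L^1_0. *)

theory Defs
  imports "HOL-Analysis.Analysis"
begin

(* Elements of L^1_loc etc. are represented by functions rather than by classes of functions equal
   a.e.  All notions below are invariant under a.e. modification, so the topology on functions
   (which is not Hausdorff) has the same dense saturated sets as the one on classes. *)

definition L1_loc :: "('a::euclidean_space \<Rightarrow> real) set" where
  "L1_loc = {f. \<forall>K. compact K \<longrightarrow> f absolutely_integrable_on K}"

definition L1_eps :: "real \<Rightarrow> ('a::euclidean_space \<Rightarrow> real) set" where
  "L1_eps \<epsilon> = {f \<in> L1_loc. integrable lebesgue (\<lambda>x. exp (- \<epsilon> * (norm x)\<^sup>2) * \<bar>f x\<bar>)}"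

definition L1_eps_norm :: "real \<Rightarrow> ('a::euclidean_space \<Rightarrow> real) \<Rightarrow> real" where
  "L1_eps_norm \<epsilon> f = (\<epsilon> / pi) powr (real DIM('a) / 2)
     * (\<integral>x. exp (- \<epsilon> * (norm x)\<^sup>2) * \<bar>f x\<bar> \<partial>lebesgue)"

definition L1_0 :: "('a::euclidean_space \<Rightarrow> real) set" where
  "L1_0 = (\<Inter>\<epsilon>\<in>{0<..}. L1_eps \<epsilon>)"

definition L1_0_topology :: "('a::euclidean_space \<Rightarrow> real) topology" where
  "L1_0_topology = topology_generated_by
     {{g \<in> L1_0. L1_eps_norm \<epsilon> (\<lambda>x. g x - f x) < r} | f \<epsilon> r. f \<in> L1_0 \<and> 0 < \<epsilon> \<and> 0 < r}"

definition L1_0_nonneg :: "('a::euclidean_space \<Rightarrow> real) set" where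
  "L1_0_nonneg = {f \<in> L1_0. AE x in lebesgue. 0 \<le> f x}"

(* Only meaningful for t > 0. *)
definition heat_solution :: "('a::euclidean_space \<Rightarrow> real) \<Rightarrow> 'a \<Rightarrow> real \<Rightarrow> real" where
  "heat_solution u\<^sub>0 x t = (4 * pi * t) powr (- (real DIM('a) / 2))
     * (\<integral>y. exp (- ((norm (x - y))\<^sup>2 / (4 * t))) * u\<^sub>0 y \<partial>lebesgue)"

(* The times t n need not all be positive; as they tend to infinity, this affects only finitely
   many of them and hence none of the limits. *)
definition oscillates :: "(nat \<Rightarrow> real) \<Rightarrow> ('a::euclidean_space \<Rightarrow> real) \<Rightarrow> bool" where
  "oscillates \<alpha> u\<^sub>0 \<longleftrightarrow>
     (\<exists>t :: nat \<Rightarrow> real. filterlim t at_top sequentially \<and>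
        (\<forall>k. \<exists>r :: nat \<Rightarrow> nat. strict_mono r \<and>
           (\<lambda>j. heat_solution u\<^sub>0 0 (t (r j))) \<longlonglongrightarrow> \<alpha> k))"

definition osc_data :: "(nat \<Rightarrow> real) \<Rightarrow> ('a::euclidean_space \<Rightarrow> real) set" where
  "osc_data \<alpha> = {u\<^sub>0 \<in> L1_0. (AE x in lebesgue. 0 \<le> u\<^sub>0 x) \<and> oscillates \<alpha> u\<^sub>0}"

(* osc_data without the sign condition.  Non-negative data form a closed proper subset of L1_0, so
   osc_data can only be dense among the non-negative functions; density in all of L1_0 is a
   statement about osc_data_signed. *)
definition osc_data_signed :: "(nat \<Rightarrow> real) \<Rightarrow> ('a::euclidean_space \<Rightarrow> real) set" where
  "osc_data_signed \<alpha> = {u\<^sub>0 \<in> L1_0. oscillates \<alpha> u\<^sub>0}"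

lemma topspace_L1_0_topology: "topspace L1_0_topology = L1_0"
proof -
  have "f \<in> {g \<in> L1_0. L1_eps_norm 1 (\<lambda>x. g x - f x) < 1}" if "f \<in> L1_0" 
    for f :: "'a::euclidean_space \<Rightarrow> real"
    using that by (simp add: L1_eps_norm_def)
  then show ?thesis
    unfolding L1_0_topology_def topology_generated_by_topspace
    by (intro equalityI subsetI) (blast, use zero_less_one in blast)
qed

lemma L1_0_measurable:
  fixes f :: "'a::euclidean_space \<Rightarrow> real"
  assumes "f \<in> L1_0"
  shows "f \<in> borel_measurable lebesgue"
proof -
  have "f \<in> L1_loc"
    using assms by (auto simp: L1_0_def L1_eps_def dest!: bspec[of _ _ 1])
  then have m: "(\<lambda>x. indicator (cball 0 (real n)) x *\<^sub>R f x) \<in> borel_measurable lebesgue" for n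
    unfolding L1_loc_def set_integrable_def
    using compact_cball borel_measurable_integrable by blast
  have "(\<lambda>n. indicator (cball 0 (real n)) x *\<^sub>R f x) \<longlonglongrightarrow> f x" for x
  proof (rule tendsto_eventually)
    obtain N :: nat where "norm x \<le> real N"
      using real_arch_simple by blast
    then show "\<forall>\<^sub>F n in sequentially. indicator (cball 0 (real n)) x *\<^sub>R f x = f x"
      by (intro eventually_sequentiallyI[of N]) (auto simp: indicator_def)
  qed
  then show ?thesis
    using m by (rule borel_measurable_LIMSEQ_metric[rotated])
qed

lemma L1_0_diff_integrable:
  fixes f g :: "'a::euclidean_space \<Rightarrow> real"
  assumes "f \<in> L1_0" "g \<in> L1_0" "0 < \<epsilon>"
  shows "integrable lebesgue (\<lambda>x. exp (- \<epsilon> * (norm x)\<^sup>2) * \<bar>f x - g x\<bar>)"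
proof (rule Bochner_Integration.integrable_bound)
  show "integrable lebesgue (\<lambda>x. exp (- \<epsilon> * (norm x)\<^sup>2) * \<bar>f x\<bar> + exp (- \<epsilon> * (norm x)\<^sup>2) * \<bar>g x\<bar>)"
    using assms by (intro Bochner_Integration.integrable_add) (auto simp: L1_0_def L1_eps_def)
  have "(\<lambda>x::'a. exp (- \<epsilon> * (norm x)\<^sup>2)) \<in> borel_measurable lebesgue"
    by (intro measurable_completion) measurable
  then show "(\<lambda>x. exp (- \<epsilon> * (norm x)\<^sup>2) * \<bar>f x - g x\<bar>) \<in> borel_measurable lebesgue"
    using L1_0_measurable[OF assms(1)] L1_0_measurable[OF assms(2)] by measurable
  have "exp (- \<epsilon> * (norm x)\<^sup>2) * \<bar>f x - g x\<bar>
      \<le> exp (- \<epsilon> * (norm x)\<^sup>2) * \<bar>f x\<bar> + exp (- \<epsilon> * (norm x)\<^sup>2) * \<bar>g x\<bar>" for x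
    unfolding distrib_left[symmetric] by (intro mult_left_mono) auto
  then show "AE x in lebesgue. norm (exp (- \<epsilon> * (norm x)\<^sup>2) * \<bar>f x - g x\<bar>)
      \<le> norm (exp (- \<epsilon> * (norm x)\<^sup>2) * \<bar>f x\<bar> + exp (- \<epsilon> * (norm x)\<^sup>2) * \<bar>g x\<bar>)"
    by (simp add: abs_mult)
qed

lemma L1_eps_norm_triangle:
  fixes f g h :: "'a::euclidean_space \<Rightarrow> real"
  assumes "f \<in> L1_0" "g \<in> L1_0" "h \<in> L1_0" "0 < \<epsilon>"
  shows "L1_eps_norm \<epsilon> (\<lambda>x. f x - h x)
    \<le> L1_eps_norm \<epsilon> (\<lambda>x. f x - g x) + L1_eps_norm \<epsilon> (\<lambda>x. g x - h x)"
proof -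
  have "(\<integral>x. exp (- \<epsilon> * (norm x)\<^sup>2) * \<bar>f x - h x\<bar> \<partial>lebesgue)
    \<le> (\<integral>x. exp (- \<epsilon> * (norm x)\<^sup>2) * \<bar>f x - g x\<bar> + exp (- \<epsilon> * (norm x)\<^sup>2) * \<bar>g x - h x\<bar> \<partial>lebesgue)"
  proof (intro integral_mono Bochner_Integration.integrable_add L1_0_diff_integrable assms)
    fix x :: 'a
    show "exp (- \<epsilon> * (norm x)\<^sup>2) * \<bar>f x - h x\<bar>
      \<le> exp (- \<epsilon> * (norm x)\<^sup>2) * \<bar>f x - g x\<bar> + exp (- \<epsilon> * (norm x)\<^sup>2) * \<bar>g x - h x\<bar>"
      unfolding distrib_left[symmetric] by (intro mult_left_mono) auto
  qed
  also have "\<dots> = (\<integral>x. exp (- \<epsilon> * (norm x)\<^sup>2) * \<bar>f x - g x\<bar> \<partial>lebesgue)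
      + (\<integral>x. exp (- \<epsilon> * (norm x)\<^sup>2) * \<bar>g x - h x\<bar> \<partial>lebesgue)"
    by (intro Bochner_Integration.integral_add L1_0_diff_integrable assms)
  finally show ?thesis
    unfolding L1_eps_norm_def distrib_left[symmetric] by (intro mult_left_mono) auto
qed

lemma L1_eps_norm_nonneg: "0 \<le> L1_eps_norm \<epsilon> f"
  by (auto simp: L1_eps_norm_def intro!: mult_nonneg_nonneg Bochner_Integration.integral_nonneg)

lemma limitin_L1_0_topology:
  fixes u :: "nat \<Rightarrow> 'a::euclidean_space \<Rightarrow> real"
  assumes u: "\<And>n. u n \<in> L1_0" and f: "f \<in> L1_0"
  shows "limitin L1_0_topology u f sequentially \<longleftrightarrow>
    (\<forall>\<epsilon>>0. (\<lambda>n. L1_eps_norm \<epsilon> (\<lambda>x. u n x - f x)) \<longlonglongrightarrow> 0)" (is "_ \<longleftrightarrow> ?R")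
proof
  assume lim: "limitin L1_0_topology u f sequentially"
  show ?R
  proof (intro allI impI)
    fix \<epsilon> :: real assume e: "0 < \<epsilon>"
    show "(\<lambda>n. L1_eps_norm \<epsilon> (\<lambda>x. u n x - f x)) \<longlonglongrightarrow> 0"
    proof (rule tendstoI)
      fix r :: real assume r: "0 < r"
      have "openin L1_0_topology {g \<in> L1_0. L1_eps_norm \<epsilon> (\<lambda>x. g x - f x) < r}"
        unfolding L1_0_topology_def by (rule topology_generated_by_Basis) (use f e r in blast)
      moreover have "f \<in> {g \<in> L1_0. L1_eps_norm \<epsilon> (\<lambda>x. g x - f x) < r}"
        using f r by (simp add: L1_eps_norm_def)
      ultimately have "\<forall>\<^sub>F n in sequentially. u n \<in> {g \<in> L1_0. L1_eps_norm \<epsilon> (\<lambda>x. g x - f x) < r}"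
        using lim unfolding limitin_def by blast
      then show "\<forall>\<^sub>F n in sequentially. dist (L1_eps_norm \<epsilon> (\<lambda>x. u n x - f x)) 0 < r"
        by eventually_elim (simp add: L1_eps_norm_nonneg)
    qed
  qed
next
  assume R: ?R
  let ?B = "{{g \<in> L1_0. L1_eps_norm \<epsilon> (\<lambda>x. g x - f x) < r} | (f :: 'a \<Rightarrow> real) \<epsilon> r. f \<in> L1_0 \<and> 0 < \<epsilon> \<and> 0 < r}"
  have ev: "f \<in> U \<longrightarrow> (\<forall>\<^sub>F n in sequentially. u n \<in> U)" if "generate_topology_on ?B U" for U
    using that
  proof induction
    case Empty
    then show ?case by simp
  next
    case (Int a b)
    then show ?case by (auto intro: eventually_conj)
  next
    case (UN K)
    show ?case
    proof
      assume "f \<in> \<Union> K"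
      then obtain k where k: "k \<in> K" "f \<in> k" by blast
      with UN have "\<forall>\<^sub>F n in sequentially. u n \<in> k" by blast
      then show "\<forall>\<^sub>F n in sequentially. u n \<in> \<Union> K"
        by eventually_elim (use k in blast)
    qed
  next
    case (Basis s)
    then obtain h \<epsilon> r where s: "s = {g \<in> L1_0. L1_eps_norm \<epsilon> (\<lambda>x. g x - h x) < r}"
      and h: "h \<in> L1_0" "0 < \<epsilon>" "0 < r" by blast
    show ?case
    proof
      assume "f \<in> s"
      then have d: "0 < r - L1_eps_norm \<epsilon> (\<lambda>x. f x - h x)" by (simp add: s)
      have "\<forall>\<^sub>F n in sequentially. L1_eps_norm \<epsilon> (\<lambda>x. u n x - f x) < r - L1_eps_norm \<epsilon> (\<lambda>x. f x - h x)"
        using R h(2) d by (intro order_tendstoD(2)[where y = 0]) auto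
      then show "\<forall>\<^sub>F n in sequentially. u n \<in> s"
      proof eventually_elim
        case (elim n)
        then show ?case
          using L1_eps_norm_triangle[OF u[of n] f h(1) h(2)] u[of n] by (simp add: s)
      qed
    qed
  qed
  show "limitin L1_0_topology u f sequentially"
    unfolding limitin_def topspace_L1_0_topology
    using f ev by (auto simp: L1_0_topology_def openin_topology_generated_by_iff)
qed

end

theory Submission
  imports Defs "HOL-Real_Asymp.Real_Asymp" "HOL-Library.Nat_Bijection"
begin

text \<open>
  The oscillation of the heat solution at the origin depends only on the datum near infinity:
  an integrable perturbation supported in a ball changes the solution at time \<open>t\<close> by
  \<open>O(t\<^bsup>-d/2\<^esup>)\<close>.  On the other hand, in \<open>L\<^sup>1\<^sub>0\<close> every function is the limit of its restrictions to
  large balls, and outside the balls one may put any fixed function of the space instead of zero.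
  Hence, once a single non-negative datum \<open>h\<close> with the prescribed oscillation is known, the functions
  that agree with \<open>f\<close> on the ball of radius \<open>n\<close> and with \<open>h\<close> outside all oscillate as prescribed and
  converge to \<open>f\<close>; they are non-negative if \<open>f\<close> is (lemmas \<open>oscillates_splice\<close> and
  \<open>limitin_splice\<close>).

  The datum \<open>h\<close> is a sum of bumps.  The bump at scale \<open>t\<close> lives at distance comparable to \<open>\<surd>t\<close> from
  the origin and is normalised so that it contributes a given amount \<open>b\<close> to the solution at time
  \<open>t\<close>.  At another time \<open>s\<close> it contributes at most \<open>b\<close> times a factor depending only on \<open>t / s\<close>,
  which tends to \<open>0\<close> both for \<open>s \<lless> t\<close> (the heat has not arrived yet) and for \<open>s \<ggreater> t\<close> (it has
  spread out).  If the scales \<open>t\<^sub>n\<close> grow fast enough, even in comparison with the possibly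
  unbounded amounts \<open>b\<^sub>n\<close>, the bumps do not interfere and the solution at time \<open>t\<^sub>n\<close> is
  \<open>b\<^sub>n + o(1)\<close>.  It remains to let \<open>b\<close> run through each \<open>\<alpha>\<^sub>k\<close> infinitely often.  That \<open>h\<close> has
  a finite integral against every Gaussian comes for free, since each Gaussian is dominated by
  a multiple of the heat kernel at one of the times \<open>t\<^sub>n\<close>.
\<close>

section \<open>The space of functions integrable against every Gaussian\<close>

lemma gaussian_measurable [measurable]:
  "(\<lambda>x::'a::euclidean_space. exp (- c * (norm x)\<^sup>2)) \<in> borel_measurable lebesgue"
  by (intro measurable_completion) measurable

text \<open>Local integrability is implied by the weighted one, as a Gaussian is bounded below on
  compact sets.\<close>

lemma mem_L1_0_iff:
  fixes f :: "'a::euclidean_space \<Rightarrow> real"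
  shows "f \<in> L1_0 \<longleftrightarrow> f \<in> borel_measurable lebesgue \<and>
     (\<forall>\<epsilon>>0. integrable lebesgue (\<lambda>x. exp (- \<epsilon> * (norm x)\<^sup>2) * \<bar>f x\<bar>))" (is "_ \<longleftrightarrow> ?R")
proof
  assume "f \<in> L1_0"
  then show ?R
    using L1_0_measurable[of f] by (auto simp: L1_0_def L1_eps_def)
next
  assume R: ?R
  then have [measurable]: "f \<in> borel_measurable lebesgue"
    by simp
  have "f absolutely_integrable_on K" if "compact K" for K
  proof -
    obtain B where B: "\<And>x. x \<in> K \<Longrightarrow> norm x \<le> B"
      using compact_imp_bounded[OF \<open>compact K\<close>] by (auto simp: bounded_iff)
    have [measurable]: "K \<in> sets lebesgue"
      using that by (simp add: lmeasurable_compact fmeasurableD)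
    have "integrable lebesgue (\<lambda>x. exp (B\<^sup>2) * (exp (- 1 * (norm x)\<^sup>2) * \<bar>f x\<bar>))"
      using R by (intro integrable_mult_right) (auto dest!: spec[of _ "1::real"])
    moreover have "(\<lambda>x. indicator K x *\<^sub>R f x) \<in> borel_measurable lebesgue"
      by measurable
    moreover have "norm (indicator K x *\<^sub>R f x)
      \<le> norm (exp (B\<^sup>2) * (exp (- 1 * (norm x)\<^sup>2) * \<bar>f x\<bar>))" for x
    proof (cases "x \<in> K")
      case True
      then have "(norm x)\<^sup>2 \<le> B\<^sup>2"
        using B by (intro power_mono) auto
      then have "1 * \<bar>f x\<bar> \<le> exp (B\<^sup>2 - (norm x)\<^sup>2) * \<bar>f x\<bar>"
        by (intro mult_right_mono) auto
      then show ?thesis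
        using True by (simp add: abs_mult exp_diff exp_minus field_simps)
    qed simp
    ultimately show ?thesis
      unfolding set_integrable_def by (rule Bochner_Integration.integrable_bound[OF _ _ AE_I2])
  qed
  with R show "f \<in> L1_0"
    by (auto simp: L1_0_def L1_eps_def L1_loc_def)
qed

section \<open>Splicing two data along a sphere\<close>

definition splice :: "real \<Rightarrow> ('a::euclidean_space \<Rightarrow> real) \<Rightarrow> ('a \<Rightarrow> real) \<Rightarrow> 'a \<Rightarrow> real" where
  "splice R f h x = (if norm x \<le> R then f x else h x)"

lemma splice_in_L1_0:
  fixes f h :: "'a::euclidean_space \<Rightarrow> real"
  assumes f: "f \<in> L1_0" and h: "h \<in> L1_0"
  shows "splice R f h \<in> L1_0"
proof -
  have m [measurable]: "f \<in> borel_measurable lebesgue" "h \<in> borel_measurable lebesgue"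
    using f h by (simp_all add: mem_L1_0_iff)
  have [measurable]: "cball 0 R \<in> sets (lebesgue :: 'a measure)"
    by simp
  have "splice R f h = (\<lambda>x. if x \<in> cball 0 R then f x else h x)"
    by (auto simp: splice_def)
  also have "\<dots> \<in> borel_measurable lebesgue"
    by measurable
  finally have [measurable]: "splice R f h \<in> borel_measurable lebesgue" .
  have "integrable lebesgue (\<lambda>x. exp (- \<epsilon> * (norm x)\<^sup>2) * \<bar>splice R f h x\<bar>)" if "\<epsilon> > 0" for \<epsilon>
  proof (rule Bochner_Integration.integrable_bound)
    show "integrable lebesgue
        (\<lambda>x. exp (- \<epsilon> * (norm x)\<^sup>2) * \<bar>f x\<bar> + exp (- \<epsilon> * (norm x)\<^sup>2) * \<bar>h x\<bar>)"
      using f h that by (intro Bochner_Integration.integrable_add) (auto simp: mem_L1_0_iff)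
    show "(\<lambda>x. exp (- \<epsilon> * (norm x)\<^sup>2) * \<bar>splice R f h x\<bar>) \<in> borel_measurable lebesgue"
      by measurable
  qed (auto simp: splice_def abs_mult)
  then show ?thesis
    by (simp add: mem_L1_0_iff)
qed

text \<open>The difference to the limit is \<open>h - f\<close> restricted to the complement of a growing ball, so
  its weighted norms vanish in the limit by dominated convergence.\<close>

lemma limitin_splice:
  fixes f h :: "'a::euclidean_space \<Rightarrow> real"
  assumes f: "f \<in> L1_0" and h: "h \<in> L1_0"
  shows "limitin L1_0_topology (\<lambda>n. splice (real n) f h) f sequentially"
proof (subst limitin_L1_0_topology)
  show "splice (real n) f h \<in> L1_0" for n
    by (intro splice_in_L1_0 f h)
  show "\<forall>\<epsilon>>0. (\<lambda>n. L1_eps_norm \<epsilon> (\<lambda>x. splice (real n) f h x - f x)) \<longlonglongrightarrow> 0"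
  proof (intro allI impI)
    fix \<epsilon> :: real assume e: "\<epsilon> > 0"
    have "(\<lambda>n. \<integral>x. exp (- \<epsilon> * (norm x)\<^sup>2) * \<bar>splice (real n) f h x - f x\<bar> \<partial>lebesgue)
        \<longlonglongrightarrow> (\<integral>(x::'a). 0 \<partial>lebesgue)"
    proof (rule integral_dominated_convergence)
      show "integrable lebesgue (\<lambda>x. exp (- \<epsilon> * (norm x)\<^sup>2) * \<bar>h x - f x\<bar>)"
        by (intro L1_0_diff_integrable f h e)
      show "(\<lambda>x. exp (- \<epsilon> * (norm x)\<^sup>2) * \<bar>splice (real n) f h x - f x\<bar>)
          \<in> borel_measurable lebesgue" for n
        using L1_0_diff_integrable[OF splice_in_L1_0[OF f h] f e]
        by (rule borel_measurable_integrable)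
      show "AE x in lebesgue.
          (\<lambda>n. exp (- \<epsilon> * (norm x)\<^sup>2) * \<bar>splice (real n) f h x - f x\<bar>) \<longlonglongrightarrow> 0"
      proof (intro AE_I2 tendsto_eventually)
        fix x :: 'a
        obtain N :: nat where "norm x \<le> real N"
          using real_arch_simple by blast
        then show "\<forall>\<^sub>F n in sequentially.
            exp (- \<epsilon> * (norm x)\<^sup>2) * \<bar>splice (real n) f h x - f x\<bar> = 0"
          by (intro eventually_sequentiallyI[of N]) (auto simp: splice_def)
      qed
    qed (auto simp: splice_def)
    then show "(\<lambda>n. L1_eps_norm \<epsilon> (\<lambda>x. splice (real n) f h x - f x)) \<longlonglongrightarrow> 0"
      unfolding L1_eps_norm_def by (intro tendsto_mult_right_zero) simp
  qed
qed (rule f)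

section \<open>The heat solution at the origin\<close>

definition heat_kernel :: "real \<Rightarrow> 'a::euclidean_space \<Rightarrow> real" where
  "heat_kernel t y = (4 * pi * t) powr (- (real DIM('a) / 2)) * exp (- ((norm y)\<^sup>2 / (4 * t)))"

lemma heat_kernel_nonneg: "0 \<le> heat_kernel t y"
  by (simp add: heat_kernel_def)

lemma heat_kernel_pos: "0 < t \<Longrightarrow> 0 < heat_kernel t y"
  by (simp add: heat_kernel_def)

lemma heat_kernel_borel [measurable]: "heat_kernel t \<in> borel_measurable borel"
  unfolding heat_kernel_def [abs_def] by measurable

lemma heat_solution_0:
  "heat_solution u 0 t = (\<integral>y. heat_kernel t y * u y \<partial>lebesgue)"
  by (simp add: heat_solution_def heat_kernel_def mult.assoc)

lemma heat_kernel_integrable: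
  fixes u :: "'a::euclidean_space \<Rightarrow> real"
  assumes u: "u \<in> L1_0" and t: "t > 0"
  shows "integrable lebesgue (\<lambda>y. heat_kernel t y * u y)"
proof -
  have [measurable]: "u \<in> borel_measurable lebesgue"
    using u by (simp add: mem_L1_0_iff)
  have "integrable lebesgue (\<lambda>y. exp (- (1 / (4 * t)) * (norm y)\<^sup>2) * \<bar>u y\<bar>)"
    using u t unfolding mem_L1_0_iff by (metis zero_less_divide_1_iff zero_less_mult_iff zero_less_numeral)
  then have "integrable lebesgue (\<lambda>y. exp (- (1 / (4 * t)) * (norm y)\<^sup>2) * u y)"
  proof (rule Bochner_Integration.integrable_bound)
    show "(\<lambda>y. exp (- (1 / (4 * t)) * (norm y)\<^sup>2) * u y) \<in> borel_measurable lebesgue"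
      by measurable
  qed (simp add: abs_mult)
  then have "integrable lebesgue (\<lambda>y. (4 * pi * t) powr (- (real DIM('a) / 2)) *
      (exp (- (1 / (4 * t)) * (norm y)\<^sup>2) * u y))"
    by (rule integrable_mult_right)
  then show ?thesis
    by (simp add: heat_kernel_def mult.assoc)
qed

text \<open>Replacing a datum on a ball changes the solution at time \<open>t\<close> by at most
  \<open>(4 \<pi> t)\<^bsup>-d/2\<^esup>\<close> times the mass of the change.\<close>

lemma heat_solution_splice_tendsto:
  fixes f h :: "'a::euclidean_space \<Rightarrow> real"
  assumes f: "f \<in> L1_0" and h: "h \<in> L1_0"
  shows "((\<lambda>t. heat_solution (splice R f h) 0 t - heat_solution h 0 t) \<longlongrightarrow> 0) at_top"
proof -
  let ?d = "real DIM('a) / 2"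
  define g where "g y = indicator (cball 0 R) y *\<^sub>R (f y - h y)" for y
  have "(\<lambda>y. f y - h y) absolutely_integrable_on cball 0 R"
    using f h by (intro set_integral_diff)
      (auto simp: L1_0_def L1_eps_def L1_loc_def dest!: bspec[of _ _ "1::real"])
  then have g: "integrable lebesgue g"
    by (simp add: set_integrable_def g_def[abs_def])
  have bound: "\<bar>heat_solution (splice R f h) 0 t - heat_solution h 0 t\<bar>
      \<le> (4 * pi * t) powr (- ?d) * (\<integral>y. \<bar>g y\<bar> \<partial>lebesgue)" if t: "t > 0" for t
  proof -
    have "heat_solution (splice R f h) 0 t - heat_solution h 0 t
        = (\<integral>y. heat_kernel t y * splice R f h y - heat_kernel t y * h y \<partial>lebesgue)"
      unfolding heat_solution_0
      by (intro Bochner_Integration.integral_diff [symmetric] heat_kernel_integrable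
          splice_in_L1_0 f h t)
    also have "\<bar>\<dots>\<bar> \<le> (\<integral>y. \<bar>heat_kernel t y * splice R f h y - heat_kernel t y * h y\<bar> \<partial>lebesgue)"
      by (rule integral_abs_bound)
    also have "\<dots> \<le> (\<integral>y. (4 * pi * t) powr (- ?d) * \<bar>g y\<bar> \<partial>lebesgue)"
    proof (intro integral_mono integrable_abs integrable_mult_right g
        Bochner_Integration.integrable_diff heat_kernel_integrable splice_in_L1_0 f h t)
      fix y :: 'a
      have "heat_kernel t y \<le> (4 * pi * t) powr (- ?d)"
        using t by (simp add: heat_kernel_def)
      moreover have "\<bar>heat_kernel t y * splice R f h y - heat_kernel t y * h y\<bar>
          = heat_kernel t y * \<bar>g y\<bar>"
        by (auto simp: g_def splice_def abs_mult heat_kernel_nonneg indicator_def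
            simp flip: right_diff_distrib)
      ultimately show "\<bar>heat_kernel t y * splice R f h y - heat_kernel t y * h y\<bar>
          \<le> (4 * pi * t) powr (- ?d) * \<bar>g y\<bar>"
        by (simp add: mult_right_mono)
    qed
    finally show ?thesis
      by simp
  qed
  have "?d > 0"
    by simp
  then have "((\<lambda>t. (4 * pi * t) powr (- ?d)) \<longlongrightarrow> 0) at_top"
    by real_asymp
  then have "((\<lambda>t. (4 * pi * t) powr (- ?d) * (\<integral>y. \<bar>g y\<bar> \<partial>lebesgue)) \<longlongrightarrow> 0) at_top"
    by (rule tendsto_mult_left_zero)
  moreover have "\<forall>\<^sub>F t in at_top. norm (heat_solution (splice R f h) 0 t - heat_solution h 0 t)
      \<le> (4 * pi * t) powr (- ?d) * (\<integral>y. \<bar>g y\<bar> \<partial>lebesgue)"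
    using eventually_gt_at_top[of 0] by eventually_elim (use bound in simp)
  ultimately show ?thesis
    by (rule Lim_null_comparison[rotated])
qed

lemma oscillates_splice:
  fixes f h :: "'a::euclidean_space \<Rightarrow> real"
  assumes f: "f \<in> L1_0" and h: "h \<in> L1_0" and osc: "oscillates \<alpha> h"
  shows "oscillates \<alpha> (splice R f h)"
proof -
  obtain t where t: "filterlim t at_top sequentially"
    and r: "\<And>k. \<exists>r :: nat \<Rightarrow> nat. strict_mono r \<and>
           (\<lambda>j. heat_solution h 0 (t (r j))) \<longlonglongrightarrow> \<alpha> k"
    using osc unfolding oscillates_def by blast
  have "\<exists>r :: nat \<Rightarrow> nat. strict_mono r \<and>
           (\<lambda>j. heat_solution (splice R f h) 0 (t (r j))) \<longlonglongrightarrow> \<alpha> k" for k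
  proof -
    obtain r :: "nat \<Rightarrow> nat" where r: "strict_mono r" "(\<lambda>j. heat_solution h 0 (t (r j))) \<longlonglongrightarrow> \<alpha> k"
      using r by blast
    have "filterlim (\<lambda>j. t (r j)) at_top sequentially"
      using filterlim_compose[OF t filterlim_subseq[OF r(1)]] .
    from filterlim_compose[OF heat_solution_splice_tendsto[OF f h] this]
    have "(\<lambda>j. heat_solution (splice R f h) 0 (t (r j)) - heat_solution h 0 (t (r j))) \<longlonglongrightarrow> 0" .
    from tendsto_add[OF this r(2)] r(1) show ?thesis
      by auto
  qed
  with t show ?thesis
    unfolding oscillates_def by blast
qed

section \<open>Bumps\<close>

text \<open>For \<open>x = t / s\<close> this bounds the quotient of the heat kernels at times \<open>s\<close> and \<open>t\<close>, at
  distance about \<open>\<surd>t\<close> from the origin.  It tends to \<open>0\<close> both for \<open>x \<rightarrow> 0\<close> and for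
  \<open>x \<rightarrow> \<infinity>\<close>.\<close>

definition decay :: "nat \<Rightarrow> real \<Rightarrow> real" where
  "decay d x = x powr (real d / 2) * exp (1 - x / 4)"

text \<open>The exponents differ by \<open>|y|\<^sup>2 / 4t - |y|\<^sup>2 / 4s\<close>, which is at most \<open>1 - t / 4s\<close> by the two
  bounds on \<open>|y|\<close>; this covers both \<open>s < t\<close> and \<open>s > t\<close>.\<close>

lemma heat_kernel_le_decay:
  fixes y :: "'a::euclidean_space"
  assumes s: "s > 0" and t: "t > 0" and y: "sqrt t \<le> norm y" "norm y \<le> 2 * sqrt t"
  shows "heat_kernel s y \<le> decay DIM('a) (t / s) * heat_kernel t y"
proof -
  let ?d = "real DIM('a) / 2"
  have "t = (sqrt t)\<^sup>2"
    using t by simp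
  also have "\<dots> \<le> (norm y)\<^sup>2"
    using y t by (intro power_mono) auto
  finally have "t / (4 * s) \<le> (norm y)\<^sup>2 / (4 * s)"
    using s by (intro divide_right_mono) auto
  moreover have "(norm y)\<^sup>2 \<le> (2 * sqrt t)\<^sup>2"
    using y t by (intro power_mono) auto
  then have "(norm y)\<^sup>2 / (4 * t) \<le> 1"
    using t by (simp add: power_mult_distrib)
  ultimately have "exp (- ((norm y)\<^sup>2 / (4 * s)))
      \<le> exp (1 - t / s / 4) * exp (- ((norm y)\<^sup>2 / (4 * t)))"
    by (simp flip: exp_add add: mult.commute)
  moreover have "(4 * pi * s) powr (- ?d) = (t / s) powr ?d * (4 * pi * t) powr (- ?d)"
    using s t by (simp add: powr_minus powr_divide powr_mult field_simps)
  ultimately have "heat_kernel s y \<le> ((t / s) powr ?d * (4 * pi * t) powr (- ?d)) *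
      (exp (1 - t / s / 4) * exp (- ((norm y)\<^sup>2 / (4 * t))))"
    unfolding heat_kernel_def by (metis mult_left_mono powr_ge_zero)
  then show ?thesis
    by (simp add: heat_kernel_def decay_def mult_ac)
qed

text \<open>A ball inside the annulus \<open>\<surd>t \<le> |y| \<le> 2 \<surd>t\<close>.\<close>

definition bump_support :: "real \<Rightarrow> 'a::euclidean_space set" where
  "bump_support t = ball ((3 / 2 * sqrt t) *\<^sub>R (SOME i. i \<in> Basis)) (sqrt t / 2)"

lemma norm_bump_support:
  assumes "y \<in> bump_support t" "t > 0"
  shows "sqrt t \<le> norm y" "norm y \<le> 2 * sqrt t"
proof -
  define c :: 'a where "c = (3 / 2 * sqrt t) *\<^sub>R (SOME i. i \<in> Basis)"
  have "norm (SOME i::'a. i \<in> Basis) = 1"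
    by (intro norm_Basis some_in_eq[THEN iffD2]) simp
  then have "norm c = 3 / 2 * sqrt t"
    using assms(2) by (simp add: c_def)
  moreover have "norm (c - y) < sqrt t / 2"
    using assms(1) by (simp add: bump_support_def c_def dist_norm)
  ultimately show "sqrt t \<le> norm y" "norm y \<le> 2 * sqrt t"
    using norm_triangle_ineq2[of c y] norm_triangle_ineq2[of y c]
    by (auto simp: norm_minus_commute)
qed

text \<open>Dividing by the heat kernel makes the contribution at time \<open>t\<close> exactly \<open>b\<close>.\<close>

definition bump :: "real \<Rightarrow> real \<Rightarrow> 'a::euclidean_space \<Rightarrow> real" where
  "bump b t y = b / measure lebesgue (bump_support t :: 'a set)
     * indicator (bump_support t) y / heat_kernel t y"

lemma bump_nonneg: "b \<ge> 0 \<Longrightarrow> 0 \<le> bump b t y"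
  by (simp add: bump_def heat_kernel_nonneg)

lemma bump_borel [measurable]: "bump b t \<in> borel_measurable borel"
proof -
  have [measurable]: "bump_support t \<in> sets (borel :: 'a measure)"
    by (simp add: bump_support_def)
  show ?thesis
    unfolding bump_def [abs_def] by measurable
qed

lemma has_integral_heat_kernel_bump:
  fixes t b :: real
  assumes "t > 0"
  shows "has_bochner_integral lebesgue (\<lambda>y::'a::euclidean_space. heat_kernel t y * bump b t y) b"
proof -
  let ?A = "bump_support t :: 'a set"
  have "measure lebesgue ?A > 0"
    using assms by (simp add: bump_support_def content_ball_pos)
  moreover have "has_bochner_integral lebesgue (\<lambda>y. b / measure lebesgue ?A * indicator ?A y)
      (b / measure lebesgue ?A * measure lebesgue ?A)"
    by (intro has_bochner_integral_mult_right has_bochner_integral_real_indicator)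
      (use emeasure_lborel_ball_finite in \<open>auto simp: bump_support_def\<close>)
  moreover have "heat_kernel t y * bump b t y = b / measure lebesgue ?A * indicator ?A y" for y
    using heat_kernel_pos[OF assms, of y] by (simp add: bump_def)
  ultimately show ?thesis
    by simp
qed

lemma heat_kernel_bump_le:
  fixes y :: "'a::euclidean_space"
  assumes "s > 0" "t > 0" "b \<ge> 0"
  shows "heat_kernel s y * bump b t y
    \<le> decay DIM('a) (t / s) * (heat_kernel t y * bump b t y)"
proof (cases "y \<in> bump_support t")
  case True
  show ?thesis
    unfolding mult.assoc[symmetric]
    by (intro mult_right_mono heat_kernel_le_decay norm_bump_support[OF True] bump_nonneg assms)
next
  case False
  then show ?thesis
    by (simp add: bump_def)
qed

lemma
  fixes b :: real
  assumes "s > 0" "t > 0" "b \<ge> 0"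
  shows integrable_heat_kernel_bump:
      "integrable lebesgue (\<lambda>y::'a::euclidean_space. heat_kernel s y * bump b t y)" (is ?I)
    and integral_heat_kernel_bump_le:
      "(\<integral>(y::'a). heat_kernel s y * bump b t y \<partial>lebesgue) \<le> decay DIM('a) (t / s) * b"
proof -
  note K = has_integral_heat_kernel_bump[OF assms(2), of b, where 'a = 'a,
      THEN has_bochner_integral_mult_right, of "decay DIM('a) (t / s)"]
  show ?I
  proof (rule Bochner_Integration.integrable_bound)
    show "integrable lebesgue (\<lambda>y::'a. decay DIM('a) (t / s) * (heat_kernel t y * bump b t y))"
      using K by (rule integrable.intros)
    show "(\<lambda>y::'a. heat_kernel s y * bump b t y) \<in> borel_measurable lebesgue"
      by (intro measurable_completion) measurable
    show "AE y::'a in lebesgue. norm (heat_kernel s y * bump b t y)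
        \<le> norm (decay DIM('a) (t / s) * (heat_kernel t y * bump b t y))"
    proof (intro AE_I2)
      fix y :: 'a
      have "0 \<le> heat_kernel s y * bump b t y"
        using assms by (simp add: heat_kernel_nonneg bump_nonneg)
      with heat_kernel_bump_le[OF assms, of y]
      show "norm (heat_kernel s y * bump b t y)
        \<le> norm (decay DIM('a) (t / s) * (heat_kernel t y * bump b t y))"
        by simp
    qed
  qed
  then have "(\<integral>(y::'a). heat_kernel s y * bump b t y \<partial>lebesgue)
      \<le> (\<integral>(y::'a). decay DIM('a) (t / s) * (heat_kernel t y * bump b t y) \<partial>lebesgue)"
    by (intro integral_mono heat_kernel_bump_le assms integrable.intros[OF K])
  also have "\<dots> = decay DIM('a) (t / s) * b"
    using K by (rule has_bochner_integral_integral_eq)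
  finally show "(\<integral>(y::'a). heat_kernel s y * bump b t y \<partial>lebesgue) \<le> decay DIM('a) (t / s) * b" .
qed

section \<open>A non-negative datum with prescribed oscillation\<close>

text \<open>Each scale is chosen so large, depending on all the previous ones and on its own amplitude,
  that the interference with each earlier scale is small in both directions.  The bound is
  summable over \<open>j\<close>, with a sum that tends to \<open>0\<close> in \<open>n\<close>.\<close>

lemma sparse_scales_exist:
  fixes b :: "nat \<Rightarrow> real" and d :: nat
  assumes d: "d > 0"
  obtains t :: "nat \<Rightarrow> real" where "\<And>n. real n + 1 \<le> t n"
    and "\<And>n j. j \<noteq> n \<Longrightarrow> decay d (t j / t n) * b j \<le> (1 / 2) ^ j * (1 / 2) ^ n"
proof -
  define P where "P t n r \<longleftrightarrow> real n + 1 \<le> r \<and> (\<forall>j<n.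
      decay d (t j / r) * b j \<le> (1 / 2) ^ j * (1 / 2) ^ n \<and>
      decay d (r / t j) * b n \<le> (1 / 2) ^ j * (1 / 2) ^ n)" for t n and r :: real
  have "\<exists>t. \<forall>n. P t n (t n)"
  proof (rule dependent_wellorder_choice)
    show "P f n r = P g n r" if "\<And>j. j < n \<Longrightarrow> f j = g j" for r f g n
      using that by (auto simp: P_def)
    fix n f assume IH: "\<And>j. j < n \<Longrightarrow> P f j (f j)"
    have "\<forall>\<^sub>F r in at_top. decay d (f j / r) * b j \<le> (1 / 2) ^ j * (1 / 2) ^ n \<and>
      decay d (r / f j) * b n \<le> (1 / 2) ^ j * (1 / 2) ^ n" if "j < n" for j
    proof -
      have pos: "f j > 0" "real d / 2 > 0"
        using IH[OF that] d by (auto simp: P_def)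
      have e: "(0::real) < (1 / 2) ^ j * (1 / 2) ^ n"
        by simp
      have "((\<lambda>r. decay d (f j / r)) \<longlongrightarrow> 0) at_top" "((\<lambda>r. decay d (r / f j)) \<longlongrightarrow> 0) at_top"
        unfolding decay_def using pos by real_asymp+
      then have "((\<lambda>r. decay d (f j / r) * b j) \<longlongrightarrow> 0) at_top"
        "((\<lambda>r. decay d (r / f j) * b n) \<longlongrightarrow> 0) at_top"
        by (auto intro: tendsto_mult_left_zero)
      from this[THEN order_tendstoD(2), OF e] show ?thesis
        by eventually_elim auto
    qed
    then have "\<forall>\<^sub>F r in at_top. \<forall>j\<in>{..<n}. decay d (f j / r) * b j \<le> (1 / 2) ^ j * (1 / 2) ^ n \<and>
      decay d (r / f j) * b n \<le> (1 / 2) ^ j * (1 / 2) ^ n"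
      by (intro eventually_ball_finite) auto
    then have "\<forall>\<^sub>F r in at_top. P f n r"
      using eventually_ge_at_top[of "real n + 1"] by eventually_elim (auto simp: P_def)
    then show "\<exists>r. P f n r"
      using eventually_happens'[OF trivial_limit_at_top_linorder] by blast
  qed
  then obtain t where t: "\<And>n. P t n (t n)"
    by blast
  show thesis
  proof
    show "real n + 1 \<le> t n" for n
      using t[of n] by (simp add: P_def)
    show "decay d (t j / t n) * b j \<le> (1 / 2) ^ j * (1 / 2) ^ n" if "j \<noteq> n" for n j
      using that t[of n] t[of j] by (cases j n rule: linorder_cases) (auto simp: P_def mult.commute)
  qed
qed

lemma datum_with_asymptotic_values_exists:
  fixes b :: "nat \<Rightarrow> real"
  assumes b: "\<And>n. b n \<ge> 0"
  obtains h :: "'a::euclidean_space \<Rightarrow> real" and t :: "nat \<Rightarrow> real"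
  where "h \<in> L1_0" "\<And>x. 0 \<le> h x" "filterlim t at_top sequentially"
    "(\<lambda>n. heat_solution h 0 (t n) - b n) \<longlonglongrightarrow> 0"
proof -
  obtain t :: "nat \<Rightarrow> real" where t: "\<And>n. real n + 1 \<le> t n"
    and sparse: "\<And>n j. j \<noteq> n \<Longrightarrow> decay DIM('a) (t j / t n) * b j \<le> (1 / 2) ^ j * (1 / 2) ^ n"
    using sparse_scales_exist[of "DIM('a)" b] by auto
  have t0: "t n > 0" for n
    using t[of n] by linarith
  have t_lim: "filterlim t at_top sequentially"
  proof (rule filterlim_at_top_mono)
    show "filterlim (\<lambda>n. real n) at_top sequentially"
      by (rule filterlim_real_sequentially)
    show "\<forall>\<^sub>F n in sequentially. real n \<le> t n"
      using t by (intro always_eventually allI) (smt (verit))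
  qed
  define h :: "'a \<Rightarrow> real" where "h y = (\<Sum>j. bump (b j) (t j) y)" for y
  define a where "a n j = (\<integral>(y::'a). heat_kernel (t n) y * bump (b j) (t j) y \<partial>lebesgue)" for n j

  \<comment> \<open>Every point lies in the supports of finitely many bumps only, as these move to infinity.\<close>
  have summable_bumps: "summable (\<lambda>j. bump (b j) (t j) y)" for y :: 'a
  proof -
    have "\<forall>\<^sub>F j in sequentially. (norm y)\<^sup>2 < t j"
      using t_lim by (auto simp: filterlim_at_top_dense)
    then have "\<forall>\<^sub>F j in sequentially. bump (b j) (t j) y = 0"
    proof eventually_elim
      case (elim j)
      then have "norm y < sqrt (t j)"
        by (simp add: real_less_rsqrt)
      then have "y \<notin> bump_support (t j)"
        using norm_bump_support(1)[OF _ t0, of y j] by auto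
      then show ?case
        by (simp add: bump_def)
    qed
    then obtain N where "\<And>j. j \<ge> N \<Longrightarrow> bump (b j) (t j) y = 0"
      by (auto simp: eventually_sequentially)
    then show ?thesis
      by (intro summable_finite[of "{..<N}"]) auto
  qed
  have h_nonneg: "0 \<le> h y" for y
    unfolding h_def by (intro suminf_nonneg summable_bumps bump_nonneg b)
  have "h \<in> borel_measurable borel"
    unfolding h_def [abs_def] by measurable
  then have [measurable]: "h \<in> borel_measurable lebesgue"
    by (intro measurable_completion) simp

  have a_nonneg: "0 \<le> a n j" for n j
    unfolding a_def
    by (intro Bochner_Integration.integral_nonneg mult_nonneg_nonneg heat_kernel_nonneg
        bump_nonneg b)
  have a_diag: "a n n = b n" for n
    unfolding a_def using has_integral_heat_kernel_bump[OF t0]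
    by (rule has_bochner_integral_integral_eq)
  have a_le: "a n j \<le> (1 / 2) ^ j * (1 / 2) ^ n" if "j \<noteq> n" for n j
    unfolding a_def using integral_heat_kernel_bump_le[OF t0 t0 b] sparse[OF that]
    by (rule order_trans)
  have a_off_diag: "0 \<le> a n j - (if j = n then b n else 0)"
    "a n j - (if j = n then b n else 0) \<le> (1 / 2) ^ j * (1 / 2) ^ n" for n j
    using a_nonneg[of n j] a_le[of j n] a_diag[of n] by auto
  have geom: "(\<lambda>j. (1 / 2) ^ j * (1 / 2) ^ n) sums (2 * (1 / 2) ^ n :: real)" for n
    using sums_mult2[OF geometric_sums[of "1 / 2 :: real"], of "(1 / 2) ^ n"] by simp
  have diag: "(\<lambda>j. if j = n then b n else 0) sums b n" for n
    using sums_single[of n "\<lambda>_. b n"] by simp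
  have "summable (\<lambda>j. a n j - (if j = n then b n else 0))" for n
    using a_off_diag by (intro summable_comparison_test'[OF sums_summable[OF geom[of n]], of 0]) auto
  then have "summable (\<lambda>j. a n j - (if j = n then b n else 0) + (if j = n then b n else 0))" for n
    by (intro summable_add sums_summable[OF diag])
  then have summable_a: "summable (a n)" for n
    by simp

  have kernel_h: "heat_kernel s y * h y = (\<Sum>j. heat_kernel s y * bump (b j) (t j) y)" for s y
    unfolding h_def by (rule suminf_mult [symmetric, OF summable_bumps])
  have *: "integrable lebesgue (\<lambda>y. heat_kernel (t n) y * h y)"
    "a n sums (\<integral>y. heat_kernel (t n) y * h y \<partial>lebesgue)" for n
  proof -
    have "integrable lebesgue (\<lambda>y::'a. heat_kernel (t n) y * bump (b j) (t j) y)" for j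
      by (intro integrable_heat_kernel_bump t0 b)
    moreover have norm_eq: "norm (heat_kernel (t n) y * bump (b j) (t j) y)
        = heat_kernel (t n) y * bump (b j) (t j) y" for j and y :: 'a
      by (simp add: heat_kernel_nonneg bump_nonneg b)
    have "AE y::'a in lebesgue. summable (\<lambda>j. norm (heat_kernel (t n) y * bump (b j) (t j) y))"
      unfolding norm_eq by (intro AE_I2 summable_mult summable_bumps)
    moreover have "summable (\<lambda>j. \<integral>(y::'a). norm (heat_kernel (t n) y * bump (b j) (t j) y) \<partial>lebesgue)"
      unfolding norm_eq using summable_a[of n] by (simp add: a_def [abs_def])
    ultimately show "integrable lebesgue (\<lambda>y. heat_kernel (t n) y * h y)"
      "a n sums (\<integral>y. heat_kernel (t n) y * h y \<partial>lebesgue)"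
      unfolding kernel_h a_def [abs_def] by (rule integrable_suminf, rule sums_integral)
  qed

  have h_L1_0: "h \<in> L1_0"
    unfolding mem_L1_0_iff
  proof (intro conjI allI impI)
    fix \<epsilon> :: real assume e: "\<epsilon> > 0"
    \<comment> \<open>The weight is at most a multiple of the heat kernel at any scale beyond \<open>1 / 4\<epsilon>\<close>.\<close>
    obtain n where n: "1 / (4 * \<epsilon>) < t n"
      using t_lim[unfolded filterlim_at_top_dense] by (meson eventually_sequentially order_refl)
    define c where "c = (4 * pi * t n) powr (- (real DIM('a) / 2))"
    have c: "c > 0"
      using t0[of n] by (simp add: c_def)
    show "integrable lebesgue (\<lambda>x. exp (- \<epsilon> * (norm x)\<^sup>2) * \<bar>h x\<bar>)"
    proof (rule Bochner_Integration.integrable_bound)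
      show "integrable lebesgue (\<lambda>y. inverse c * (heat_kernel (t n) y * h y))"
        by (intro integrable_mult_right *)
      show "AE x in lebesgue. norm (exp (- \<epsilon> * (norm x)\<^sup>2) * \<bar>h x\<bar>)
          \<le> norm (inverse c * (heat_kernel (t n) x * h x))"
      proof (intro AE_I2)
        fix x :: 'a
        have "1 / (4 * t n) \<le> \<epsilon>"
          using n e t0[of n] by (simp add: field_simps)
        then have "1 / (4 * t n) * (norm x)\<^sup>2 \<le> \<epsilon> * (norm x)\<^sup>2"
          by (intro mult_right_mono) auto
        then have "exp (- \<epsilon> * (norm x)\<^sup>2) * h x \<le> exp (- ((norm x)\<^sup>2 / (4 * t n))) * h x"
          by (intro mult_right_mono h_nonneg) auto
        also have "\<dots> = inverse c * (heat_kernel (t n) x * h x)"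
          using c by (simp add: heat_kernel_def c_def)
        finally show "norm (exp (- \<epsilon> * (norm x)\<^sup>2) * \<bar>h x\<bar>)
          \<le> norm (inverse c * (heat_kernel (t n) x * h x))"
          using h_nonneg[of x] by simp
      qed
    qed measurable
  qed measurable

  have "norm (heat_solution h 0 (t n) - b n) \<le> 2 * (1 / 2) ^ n" for n
  proof -
    have D: "(\<lambda>j. a n j - (if j = n then b n else 0)) sums (heat_solution h 0 (t n) - b n)"
      unfolding heat_solution_0 by (intro sums_diff * diag)
    have "0 \<le> heat_solution h 0 (t n) - b n"
      using sums_le[OF a_off_diag(1) sums_zero D] .
    moreover have "heat_solution h 0 (t n) - b n \<le> 2 * (1 / 2) ^ n"
      using sums_le[OF a_off_diag(2) D geom] .
    ultimately show ?thesis
      by simp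
  qed
  moreover have "(\<lambda>n. 2 * (1 / 2) ^ n :: real) \<longlonglongrightarrow> 0"
    by real_asymp
  ultimately have "(\<lambda>n. heat_solution h 0 (t n) - b n) \<longlonglongrightarrow> 0"
    by (rule Lim_null_comparison[OF always_eventually, OF allI])
  with h_L1_0 h_nonneg t_lim show thesis
    by (rule that)
qed

lemma oscillating_datum_exists:
  assumes \<alpha>: "\<And>k. 0 \<le> \<alpha> k"
  obtains h :: "'a::euclidean_space \<Rightarrow> real" where "h \<in> L1_0" "\<And>x. 0 \<le> h x" "oscillates \<alpha> h"
proof -
  define b where "b n = \<alpha> (fst (prod_decode n))" for n
  obtain h :: "'a \<Rightarrow> real" and t where h: "h \<in> L1_0" "\<And>x. 0 \<le> h x"
    and t: "filterlim t at_top sequentially"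
    and lim: "(\<lambda>n. heat_solution h 0 (t n) - b n) \<longlonglongrightarrow> 0"
    using datum_with_asymptotic_values_exists[of b] \<alpha> by (auto simp: b_def)
  have "\<exists>r :: nat \<Rightarrow> nat. strict_mono r \<and> (\<lambda>j. heat_solution h 0 (t (r j))) \<longlonglongrightarrow> \<alpha> k" for k
  proof (intro exI conjI)
    let ?r = "\<lambda>j. prod_encode (k, j)"
    show "strict_mono ?r"
      by (simp add: strict_mono_Suc_iff prod_encode_def)
    then have "(\<lambda>j. heat_solution h 0 (t (?r j)) - b (?r j)) \<longlonglongrightarrow> 0"
      by (rule filterlim_compose[OF lim filterlim_subseq])
    then have "(\<lambda>j. heat_solution h 0 (t (?r j)) - \<alpha> k) \<longlonglongrightarrow> 0"
      by (simp add: b_def)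
    then show "(\<lambda>j. heat_solution h 0 (t (?r j))) \<longlonglongrightarrow> \<alpha> k"
      by (rule LIM_zero_cancel)
  qed
  with t have "oscillates \<alpha> h"
    unfolding oscillates_def by blast
  with h show thesis
    by (rule that)
qed

section \<open>Density\<close>

lemma limitin_imp_in_closure_of:
  assumes "limitin X u l sequentially" "\<And>n. u n \<in> S"
  shows "l \<in> X closure_of S"
  unfolding in_closure_of
proof (intro conjI allI impI)
  show "l \<in> topspace X"
    using assms(1) by (rule limitin_topspace)
  fix U assume "l \<in> U \<and> openin X U"
  then have "\<forall>\<^sub>F n in sequentially. u n \<in> U"
    using assms(1) by (auto simp: limitin_def)
  then obtain n where "u n \<in> U"
    by (auto simp: eventually_sequentially)
  then show "\<exists>y. y \<in> S \<and> y \<in> U"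
    using assms(2) by blast
qed

theorem theorem6p5:
  fixes \<alpha> :: "nat \<Rightarrow> real"
  assumes "\<And>k. 0 < \<alpha> k"
  shows "subtopology L1_0_topology L1_0_nonneg closure_of (osc_data \<alpha> :: (real ^ 'd \<Rightarrow> real) set)
           = L1_0_nonneg
       \<and> L1_0_topology closure_of (osc_data_signed \<alpha> :: (real ^ 'd \<Rightarrow> real) set) = L1_0"
proof -
  obtain h :: "real ^ 'd \<Rightarrow> real" where h: "h \<in> L1_0" "\<And>x. 0 \<le> h x" "oscillates \<alpha> h"
    using oscillating_datum_exists[of \<alpha>] assms less_imp_le by metis
  have signed: "splice R f h \<in> osc_data_signed \<alpha>" if "f \<in> L1_0" for f R
    using that by (simp add: osc_data_signed_def splice_in_L1_0 oscillates_splice h)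
  have nonneg: "splice R f h \<in> osc_data \<alpha> \<inter> L1_0_nonneg" if "f \<in> L1_0_nonneg" for f R
  proof -
    have f: "f \<in> L1_0" "AE x in lebesgue. 0 \<le> f x"
      using that by (auto simp: L1_0_nonneg_def)
    from f(2) have "AE x in lebesgue. 0 \<le> splice R f h x"
      by eventually_elim (simp add: splice_def h)
    with f(1) show ?thesis
      by (simp add: osc_data_def L1_0_nonneg_def splice_in_L1_0 oscillates_splice h)
  qed
  show ?thesis
  proof (intro conjI equalityI subsetI)
    fix f :: "real ^ 'd \<Rightarrow> real"
    assume f: "f \<in> L1_0_nonneg"
    then have "f \<in> L1_0"
      by (simp add: L1_0_nonneg_def)
    with f nonneg[OF f] have "limitin (subtopology L1_0_topology L1_0_nonneg)
        (\<lambda>n. splice (real n) f h) f sequentially"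
      using limitin_splice[OF _ h(1)] by (simp add: limitin_subtopology)
    then show "f \<in> subtopology L1_0_topology L1_0_nonneg closure_of osc_data \<alpha>"
      by (rule limitin_imp_in_closure_of) (use nonneg[OF f] in blast)
  next
    fix f :: "real ^ 'd \<Rightarrow> real"
    assume f: "f \<in> L1_0"
    show "f \<in> L1_0_topology closure_of osc_data_signed \<alpha>"
      using limitin_splice[OF f h(1)] by (rule limitin_imp_in_closure_of) (rule signed[OF f])
  qed (auto simp: in_closure_of topspace_L1_0_topology)
qed

end
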